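(* Let $\rho>0$ and let $f:\mathbb{R}^n\to\mathbb{R}$, $g:\mathbb{R}^n\to\mathbb{R}^m$, $h:\mathbb{R}^n\to\mathbb{R}^p$ be twice continuously differentiable. Let $x^*$ be an S-stationary point of (SPO) with multipliers $(\lambda^*,\mu^* )$, and suppose that SP-SOSC (respectively strong SP-SOSC) holds at $(x^*,\lambda^*,\mu^* )$. Define $y^*,\gamma^*,\sigma^*\in\mathbb{R}^n$ by $$y_i^*=1,\quad \gamma_i^*=-\nabla_{x_i}L^{SP}(x^*,\lambda^*,\mu^* ),\quad \sigma_i^*=\rho\qquad\text{if } x_i^*=0,$$ $$y_i^*=0,\quad \gamma_i^*=\frac{\rho}{x_i^*},\quad \sigma_i^*=0\qquad\text{if } x_i^*\ne0.$$ Then the following statements hold: (i) SOSC (respectively strong SOSC) for (SPOlin) holds at $(x^*,y^*,\lambda^*,\mu^*,\gamma^*,\sigma^* )$. (ii) SOSC (respectively strong SOSC) for (SPOsq) holds at $(x^*,y^*,\lambda^*,\mu^*,\gamma^* )$. (iii) $x^*$ is a local minimizer of (SPO).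
   Context: $X=\{x\in\mathbb{R}^n\mid g(x)\le 0,\ h(x)=0\}$; $\|x\|_0$ is the number of nonzero components of $x$; $e=(1,\dots,1)^T\in\mathbb{R}^n$; $\circ$ is the componentwise product; $I_0(x)=\{i\mid x_i=0\}$; $I_g(x^* )=\{i\mid g_i(x^* )=0\}$; $L^{SP}(x,\lambda,\mu)=f(x)+\lambda^Tg(x)+\mu^Th(x)$. Problems: (SPO): $\min_x f(x)+\rho\|x\|_0$ s.t. $x\in X$. (SPOlin): $\min_{(x,y)} f(x)+\rho(n-e^Ty)$ s.t. $g(x)\le0$ (multiplier $\lambda$), $h(x)=0$ (multiplier $\mu$), $x\circ y=0$ (multiplier $\gamma$), $y-e\le 0$ (multiplier $\sigma$). (SPOsq): $\min_{(x,y)} f(x)+\frac{\rho}{2}\sum_{i=1}^n y_i(y_i-2)$ s.t. $g(x)\le0$ (multiplier $\lambda$), $h(x)=0$ (multiplier $\mu$), $x\circ y=0$ (multiplier $\gamma$). $x^*$ is S-stationary for (SPO) with multipliers $(\lambda^*,\mu^* )$ if $\nabla_{x_i}L^{SP}(x^*,\lambda^*,\mu^* )=0$ for all $i\notin I_0(x^* )$; $\lambda^*\ge0$, $g(x^* )\le0$, $\lambda^*\circ g(x^* )=0$; $h(x^* )=0$. Critical cone $C^{SPO}(x^*,\lambda^* )$: all $d\in\mathbb{R}^n$ with $\nabla g_i(x^* )^Td=0$ for $i\in I_g(x^* )$ with $\lambda_i^*>0$, $\nabla g_i(x^* )^Td\le0$ for $i\in I_g(x^* )$ with $\lambda_i^*=0$,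 $\nabla h_i(x^* )^Td=0$ for all $i=1,\dots,p$, and $d_i=0$ for $i\in I_0(x^* )$. Critical subspace $SC^{SPO}(x^*,\lambda^* )$: the same without the inequality conditions for $\lambda_i^*=0$. SP-SOSC (respectively strong SP-SOSC) at $(x^*,\lambda^*,\mu^* )$: $d^T\nabla_{xx}^2L^{SP}(x^*,\lambda^*,\mu^* )d>0$ for all nonzero $d\in C^{SPO}(x^*,\lambda^* )$ (respectively all nonzero $d\in SC^{SPO}(x^*,\lambda^* )$). Standard SOSC (respectively strong SOSC) for a smooth program $\min F(z)$ s.t. $G(z)\le0$, $H(z)=0$ at a KKT point $(z^*,u^*,v^* )$ ($u^*$ multipliers for $G$, $v^*$ for $H$): $d^T\nabla^2_{zz}(F+u^{*T}G+v^{*T}H)(z^* )d>0$ for all nonzero $d$ in the critical cone (respectively critical subspace), where the critical cone consists of the $d$ with $\nabla G_i(z^* )^Td=0$ for active $i$ with $u_i^*>0$, $\nabla G_i(z^* )^Td\le0$ for active $i$ with $u_i^*=0$, and $\nabla H_j(z^* )^Td=0$ for all $j$, and the critical subspace is defined by the same conditions without those for $u_i^*=0$. *)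

theory Defs
  imports "HOL-Analysis.Analysis"
begin

text \<open>Differential calculus for real-valued functions on a Euclidean space.\<close>

definition grad :: "('z::euclidean_space \<Rightarrow> real) \<Rightarrow> 'z \<Rightarrow> 'z" where
  "grad F z = (THE D. GDERIV F z :> D)"

text \<open>The Hessian is represented as the linear map that is the derivative of the gradient; the
  quadratic form of the Hessian is then \<open>d \<bullet> hess F z d\<close>.\<close>

definition hess :: "('z::euclidean_space \<Rightarrow> real) \<Rightarrow> 'z \<Rightarrow> 'z \<Rightarrow> 'z" where
  "hess F z = frechet_derivative (grad F) (at z)"

text \<open>Continuity of the Hessian is required for each direction separately, which in finite
  dimension is continuity of the matrix of second partial derivatives.\<close>

definition twice_cont_diff :: "('z::euclidean_space \<Rightarrow> real) \<Rightarrow> bool" where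
  "twice_cont_diff F \<longleftrightarrow>
     (\<forall>z. F differentiable (at z)) \<and>
     (\<forall>z. grad F differentiable (at z)) \<and>
     (\<forall>d. continuous_on UNIV (\<lambda>z. hess F z d))"

definition local_minimizer :: "('z::metric_space \<Rightarrow> real) \<Rightarrow> 'z set \<Rightarrow> 'z \<Rightarrow> bool" where
  "local_minimizer F S z \<longleftrightarrow> z \<in> S \<and> (\<exists>\<epsilon>>0. \<forall>w\<in>S. dist w z < \<epsilon> \<longrightarrow> F z \<le> F w)"

text \<open>Smooth programs: minimize \<open>F z\<close> subject to \<open>G z \<le> 0\<close>, \<open>H z = 0\<close>. Constraints and
  multipliers are families of real-valued components over explicit finite index sets, so that
  there may be no inequality or no equality constraints; values outside the index sets are
  irrelevant.\<close>

record ('z, 'i, 'j) nlp =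
  obj :: "'z \<Rightarrow> real"
  ineq_ix :: "'i set"
  ineq :: "'i \<Rightarrow> 'z \<Rightarrow> real"
  eq_ix :: "'j set"
  eqn :: "'j \<Rightarrow> 'z \<Rightarrow> real"

definition lagrangian ::
  "('z, 'i, 'j) nlp \<Rightarrow> ('i \<Rightarrow> real) \<Rightarrow> ('j \<Rightarrow> real) \<Rightarrow> 'z \<Rightarrow> real" where
  "lagrangian P u v z =
     obj P z + (\<Sum>i\<in>ineq_ix P. u i * ineq P i z) + (\<Sum>j\<in>eq_ix P. v j * eqn P j z)"

definition KKT ::
  "('z::euclidean_space, 'i, 'j) nlp \<Rightarrow> 'z \<Rightarrow> ('i \<Rightarrow> real) \<Rightarrow> ('j \<Rightarrow> real) \<Rightarrow> bool" where
  "KKT P z u v \<longleftrightarrow>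
     grad (lagrangian P u v) z = 0 \<and>
     (\<forall>i\<in>ineq_ix P. u i \<ge> 0 \<and> ineq P i z \<le> 0 \<and> u i * ineq P i z = 0) \<and>
     (\<forall>j\<in>eq_ix P. eqn P j z = 0)"

definition critical_subspace ::
  "('z::euclidean_space, 'i, 'j) nlp \<Rightarrow> 'z \<Rightarrow> ('i \<Rightarrow> real) \<Rightarrow> 'z set" where
  "critical_subspace P z u =
     {d. (\<forall>i\<in>ineq_ix P. ineq P i z = 0 \<and> u i > 0 \<longrightarrow> grad (ineq P i) z \<bullet> d = 0) \<and>
         (\<forall>j\<in>eq_ix P. grad (eqn P j) z \<bullet> d = 0)}"

definition critical_cone ::
  "('z::euclidean_space, 'i, 'j) nlp \<Rightarrow> 'z \<Rightarrow> ('i \<Rightarrow> real) \<Rightarrow> 'z set" where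
  "critical_cone P z u =
     {d. (\<forall>i\<in>ineq_ix P. ineq P i z = 0 \<and> u i > 0 \<longrightarrow> grad (ineq P i) z \<bullet> d = 0) \<and>
         (\<forall>i\<in>ineq_ix P. ineq P i z = 0 \<and> u i = 0 \<longrightarrow> grad (ineq P i) z \<bullet> d \<le> 0) \<and>
         (\<forall>j\<in>eq_ix P. grad (eqn P j) z \<bullet> d = 0)}"

text \<open>The second-order conditions are conditions at a KKT point, so both include \<open>KKT\<close>.\<close>

definition SOSC ::
  "('z::euclidean_space, 'i, 'j) nlp \<Rightarrow> 'z \<Rightarrow> ('i \<Rightarrow> real) \<Rightarrow> ('j \<Rightarrow> real) \<Rightarrow> bool" where
  "SOSC P z u v \<longleftrightarrow> KKT P z u v \<and>
     (\<forall>d\<in>critical_cone P z u. d \<noteq> 0 \<longrightarrow> d \<bullet> hess (lagrangian P u v) z d > 0)"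

definition strong_SOSC ::
  "('z::euclidean_space, 'i, 'j) nlp \<Rightarrow> 'z \<Rightarrow> ('i \<Rightarrow> real) \<Rightarrow> ('j \<Rightarrow> real) \<Rightarrow> bool" where
  "strong_SOSC P z u v \<longleftrightarrow> KKT P z u v \<and>
     (\<forall>d\<in>critical_subspace P z u. d \<noteq> 0 \<longrightarrow> d \<bullet> hess (lagrangian P u v) z d > 0)"

text \<open>The sparse optimization problem. The maps into \<open>m\<close>- and \<open>p\<close>-dimensional space are
  given by their components \<open>g i\<close> for \<open>i < m\<close> and \<open>h j\<close> for \<open>j < p\<close>, where \<open>m\<close> and \<open>p\<close> may
  be zero.\<close>

definition feasible_X ::
  "nat \<Rightarrow> (nat \<Rightarrow> real^'n \<Rightarrow> real) \<Rightarrow> nat \<Rightarrow> (nat \<Rightarrow> real^'n \<Rightarrow> real) \<Rightarrow> (real^'n) set" where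
  "feasible_X m g p h = {x. (\<forall>i<m. g i x \<le> 0) \<and> (\<forall>j<p. h j x = 0)}"

definition l0 :: "real^'n \<Rightarrow> nat" where
  "l0 x = card {i. x $ i \<noteq> 0}"

definition SPO_obj :: "real \<Rightarrow> (real^'n \<Rightarrow> real) \<Rightarrow> real^'n \<Rightarrow> real" where
  "SPO_obj \<rho> f x = f x + \<rho> * real (l0 x)"

definition L_SP ::
  "(real^'n \<Rightarrow> real) \<Rightarrow> nat \<Rightarrow> (nat \<Rightarrow> real^'n \<Rightarrow> real) \<Rightarrow> nat \<Rightarrow> (nat \<Rightarrow> real^'n \<Rightarrow> real)
    \<Rightarrow> (nat \<Rightarrow> real) \<Rightarrow> (nat \<Rightarrow> real) \<Rightarrow> real^'n \<Rightarrow> real" where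
  "L_SP f m g p h lam mu x = f x + (\<Sum>i<m. lam i * g i x) + (\<Sum>j<p. mu j * h j x)"

definition S_stationary ::
  "(real^'n \<Rightarrow> real) \<Rightarrow> nat \<Rightarrow> (nat \<Rightarrow> real^'n \<Rightarrow> real) \<Rightarrow> nat \<Rightarrow> (nat \<Rightarrow> real^'n \<Rightarrow> real)
    \<Rightarrow> real^'n \<Rightarrow> (nat \<Rightarrow> real) \<Rightarrow> (nat \<Rightarrow> real) \<Rightarrow> bool" where
  "S_stationary f m g p h x lam mu \<longleftrightarrow>
     (\<forall>i. x $ i \<noteq> 0 \<longrightarrow> grad (L_SP f m g p h lam mu) x $ i = 0) \<and>
     (\<forall>i<m. lam i \<ge> 0 \<and> g i x \<le> 0 \<and> lam i * g i x = 0) \<and>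
     (\<forall>j<p. h j x = 0)"

definition SC_SPO ::
  "nat \<Rightarrow> (nat \<Rightarrow> real^'n \<Rightarrow> real) \<Rightarrow> nat \<Rightarrow> (nat \<Rightarrow> real^'n \<Rightarrow> real)
    \<Rightarrow> real^'n \<Rightarrow> (nat \<Rightarrow> real) \<Rightarrow> (real^'n) set" where
  "SC_SPO m g p h x lam =
     {d. (\<forall>i<m. g i x = 0 \<and> lam i > 0 \<longrightarrow> grad (g i) x \<bullet> d = 0) \<and>
         (\<forall>j<p. grad (h j) x \<bullet> d = 0) \<and>
         (\<forall>i. x $ i = 0 \<longrightarrow> d $ i = 0)}"

definition C_SPO ::
  "nat \<Rightarrow> (nat \<Rightarrow> real^'n \<Rightarrow> real) \<Rightarrow> nat \<Rightarrow> (nat \<Rightarrow> real^'n \<Rightarrow> real)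
    \<Rightarrow> real^'n \<Rightarrow> (nat \<Rightarrow> real) \<Rightarrow> (real^'n) set" where
  "C_SPO m g p h x lam =
     {d. (\<forall>i<m. g i x = 0 \<and> lam i > 0 \<longrightarrow> grad (g i) x \<bullet> d = 0) \<and>
         (\<forall>i<m. g i x = 0 \<and> lam i = 0 \<longrightarrow> grad (g i) x \<bullet> d \<le> 0) \<and>
         (\<forall>j<p. grad (h j) x \<bullet> d = 0) \<and>
         (\<forall>i. x $ i = 0 \<longrightarrow> d $ i = 0)}"

definition SP_SOSC ::
  "(real^'n \<Rightarrow> real) \<Rightarrow> nat \<Rightarrow> (nat \<Rightarrow> real^'n \<Rightarrow> real) \<Rightarrow> nat \<Rightarrow> (nat \<Rightarrow> real^'n \<Rightarrow> real)
    \<Rightarrow> real^'n \<Rightarrow> (nat \<Rightarrow> real) \<Rightarrow> (nat \<Rightarrow> real) \<Rightarrow> bool" where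
  "SP_SOSC f m g p h x lam mu \<longleftrightarrow>
     (\<forall>d\<in>C_SPO m g p h x lam. d \<noteq> 0 \<longrightarrow> d \<bullet> hess (L_SP f m g p h lam mu) x d > 0)"

definition strong_SP_SOSC ::
  "(real^'n \<Rightarrow> real) \<Rightarrow> nat \<Rightarrow> (nat \<Rightarrow> real^'n \<Rightarrow> real) \<Rightarrow> nat \<Rightarrow> (nat \<Rightarrow> real^'n \<Rightarrow> real)
    \<Rightarrow> real^'n \<Rightarrow> (nat \<Rightarrow> real) \<Rightarrow> (nat \<Rightarrow> real) \<Rightarrow> bool" where
  "strong_SP_SOSC f m g p h x lam mu \<longleftrightarrow>
     (\<forall>d\<in>SC_SPO m g p h x lam. d \<noteq> 0 \<longrightarrow> d \<bullet> hess (L_SP f m g p h lam mu) x d > 0)"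

text \<open>In the two reformulations, constraints tagged \<open>Inl\<close> are those of the original problem;
  those tagged \<open>Inr\<close> are the components of \<open>y - e \<le> 0\<close> and of \<open>x \<circ> y = 0\<close>, respectively.\<close>

definition SPOlin ::
  "real \<Rightarrow> (real^'n \<Rightarrow> real) \<Rightarrow> nat \<Rightarrow> (nat \<Rightarrow> real^'n \<Rightarrow> real) \<Rightarrow> nat \<Rightarrow> (nat \<Rightarrow> real^'n \<Rightarrow> real)
    \<Rightarrow> ((real^'n) \<times> (real^'n), nat + 'n, nat + 'n) nlp" where
  "SPOlin \<rho> f m g p h =
     \<lparr> obj = (\<lambda>(x, y). f x + \<rho> * (real CARD('n) - (\<Sum>i\<in>UNIV. y $ i))),
       ineq_ix = {..<m} <+> UNIV,
       ineq = case_sum (\<lambda>i (x, y). g i x) (\<lambda>i (x, y). y $ i - 1),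
       eq_ix = {..<p} <+> UNIV,
       eqn = case_sum (\<lambda>j (x, y). h j x) (\<lambda>i (x, y). x $ i * y $ i) \<rparr>"

definition SPOsq ::
  "real \<Rightarrow> (real^'n \<Rightarrow> real) \<Rightarrow> nat \<Rightarrow> (nat \<Rightarrow> real^'n \<Rightarrow> real) \<Rightarrow> nat \<Rightarrow> (nat \<Rightarrow> real^'n \<Rightarrow> real)
    \<Rightarrow> ((real^'n) \<times> (real^'n), nat, nat + 'n) nlp" where
  "SPOsq \<rho> f m g p h =
     \<lparr> obj = (\<lambda>(x, y). f x + \<rho> / 2 * (\<Sum>i\<in>UNIV. y $ i * (y $ i - 2))),
       ineq_ix = {..<m},
       ineq = (\<lambda>i (x, y). g i x),
       eq_ix = {..<p} <+> UNIV,
       eqn = case_sum (\<lambda>j (x, y). h j x) (\<lambda>i (x, y). x $ i * y $ i) \<rparr>"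

end

theory Submission
  imports Defs
begin

text \<open>In both reformulations the Lagrangian is, as a function of \<open>(a, b)\<close>, the sum of the
  Lagrangian \<open>L\<close> of the sparse problem in \<open>a\<close>, a quadratic function of \<open>b\<close> with second-order part
  \<open>\<kappa> / 2 * (b \<bullet> b)\<close>, and the bilinear term \<open>\<Sum>i. \<gamma> i * a i * b i\<close>; here \<open>\<kappa> = 0\<close> in the linear and
  \<open>\<kappa> = \<rho>\<close> in the quadratic case. The multipliers are chosen so that its gradient vanishes at
  \<open>(x, y)\<close>. Since \<open>x\<close> and \<open>y\<close> have complementary supports that cover all indices, the linearized
  constraint \<open>a \<circ> b = 0\<close> forces, for a critical direction \<open>(u, v)\<close>, that \<open>u i = 0\<close> where \<open>x i = 0\<close>
  and \<open>v i = 0\<close> elsewhere. Hence \<open>u\<close> is critical for the sparse problem, the bilinear term does not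
  contribute to the Hessian form, and what remains is \<open>u \<bullet> hess L x u + \<kappa> * (v \<bullet> v)\<close>. In the
  quadratic case this is positive since \<open>\<rho> > 0\<close>; in the linear case the bounds \<open>y i \<le> 1\<close> with
  multiplier \<open>\<rho> > 0\<close>, which are active where \<open>x i = 0\<close>, force the rest of \<open>v\<close> to vanish too.

  For local optimality, close points of larger support are worse because each additional nonzero
  component costs \<open>\<rho>\<close>, while \<open>f\<close> is continuous (\<open>local_minimizer_SPO_if_on_support\<close>). On the points
  whose support lies in that of \<open>x\<close>, the usual contradiction argument applies
  (\<open>local_min_on_support\<close>): a sequence of better feasible points has a limit direction, which is
  critical and on which the Hessian form of \<open>L\<close> is nonpositive
  (\<open>hess_limit_direction_nonpos\<close>). The strong condition implies the ordinary one, so it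
  needs no separate argument.\<close>

section \<open>Gradients and Hessians\<close>

lemma grad_eqI:
  assumes "GDERIV F z :> D"
  shows "grad F z = D"
  unfolding grad_def
proof (rule the_equality)
  fix D' assume "GDERIV F z :> D'"
  with assms have "(\<lambda>h. h \<bullet> D') = (\<lambda>h. h \<bullet> D)"
    unfolding gderiv_def by (blast intro: has_derivative_unique)
  then show "D' = D" by (metis vector_eq_ldot)
qed (fact assms)

text \<open>The gradient exists: in an orthonormal basis, its coordinates are the values of the
  derivative on the basis vectors.\<close>

lemma GDERIV_grad:
  assumes "F differentiable (at z)"
  shows "GDERIV F z :> grad F z"
proof -
  obtain F' where F': "(F has_derivative F') (at z)"
    using assms unfolding differentiable_def by blast
  then interpret F': bounded_linear F' by (rule has_derivative_bounded_linear)
  define D where "D = (\<Sum>b\<in>Basis. F' b *\<^sub>R b)"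
  have "F' h = h \<bullet> D" for h
  proof -
    have "F' h = F' (\<Sum>b\<in>Basis. (h \<bullet> b) *\<^sub>R b)" by (simp add: euclidean_representation)
    also have "\<dots> = h \<bullet> D"
      by (simp add: D_def F'.sum F'.scaleR inner_sum_right mult.commute)
    finally show ?thesis .
  qed
  then have "F' = (\<lambda>h. h \<bullet> D)" by blast
  with F' have "GDERIV F z :> D" by (simp add: gderiv_def)
  then show ?thesis by (simp add: grad_eqI)
qed

lemma has_derivative_grad_hess:
  assumes "grad F differentiable (at z)"
  shows "(grad F has_derivative hess F z) (at z)"
  using assms unfolding hess_def by (simp add: frechet_derivative_works)

lemma hess_eqI:
  assumes "(grad F has_derivative D) (at z)"
  shows "hess F z = D"
  using frechet_derivative_at[OF assms] by (simp add: hess_def)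

lemma grad_differentiable_lincomb:
  fixes c :: "'i \<Rightarrow> real"
  assumes "finite I"
    and "\<And>z. f differentiable (at z)" "\<And>z. grad f differentiable (at z)"
    and "\<And>i z. i \<in> I \<Longrightarrow> g i differentiable (at z)"
    and "\<And>i z. i \<in> I \<Longrightarrow> grad (g i) differentiable (at z)"
  shows "(\<lambda>z. f z + (\<Sum>i\<in>I. c i * g i z)) differentiable (at z)"
    and "grad (\<lambda>z. f z + (\<Sum>i\<in>I. c i * g i z)) z = grad f z + (\<Sum>i\<in>I. c i *\<^sub>R grad (g i) z)"
    and "grad (\<lambda>z. f z + (\<Sum>i\<in>I. c i * g i z)) differentiable (at z)"
proof -
  show "(\<lambda>z. f z + (\<Sum>i\<in>I. c i * g i z)) differentiable (at z)"
    using assms by (auto intro!: derivative_intros)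
  have eq: "grad (\<lambda>z. f z + (\<Sum>i\<in>I. c i * g i z)) z = grad f z + (\<Sum>i\<in>I. c i *\<^sub>R grad (g i) z)" for z
  proof (rule grad_eqI)
    show "GDERIV (\<lambda>z. f z + (\<Sum>i\<in>I. c i * g i z)) z :> grad f z + (\<Sum>i\<in>I. c i *\<^sub>R grad (g i) z)"
      unfolding gderiv_def
      using GDERIV_grad[OF assms(2)] GDERIV_grad[OF assms(4)]
      by (auto simp: gderiv_def inner_add_right inner_sum_right intro!: derivative_intros)
  qed
  then show "grad (\<lambda>z. f z + (\<Sum>i\<in>I. c i * g i z)) z = grad f z + (\<Sum>i\<in>I. c i *\<^sub>R grad (g i) z)" .
  show "grad (\<lambda>z. f z + (\<Sum>i\<in>I. c i * g i z)) differentiable (at z)"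
    unfolding eq[abs_def] using assms by (auto intro!: derivative_intros)
qed

lemma grad_fst:
  fixes F :: "'a::euclidean_space \<Rightarrow> real" and b :: "'b::euclidean_space"
  assumes "F differentiable (at a)"
  shows "grad (\<lambda>(x, y). F x) (a, b) = (grad F a, 0)"
proof (rule grad_eqI)
  have "(F has_derivative (\<lambda>h. h \<bullet> grad F a)) (at (fst (a, b)))"
    using GDERIV_grad[OF assms] by (simp add: gderiv_def)
  then have "((\<lambda>z. F (fst z)) has_derivative (\<lambda>h. fst h \<bullet> grad F a)) (at (a, b))"
    by (rule has_derivative_compose[OF has_derivative_fst[OF has_derivative_ident]])
  then show "GDERIV (\<lambda>(x, y). F x) (a, b) :> (grad F a, 0)"
    by (simp add: gderiv_def split_def inner_Pair_0)
qed

section \<open>The Lagrangians of the reformulated problems\<close>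

text \<open>The componentwise product of two vectors.\<close>

definition hadamard :: "real^'n \<Rightarrow> real^'n \<Rightarrow> real^'n" where
  "hadamard c b = (\<chi> i. c $ i * b $ i)"

lemma hadamard_nth [simp]: "hadamard c b $ i = c $ i * b $ i"
  by (simp add: hadamard_def)

lemma bounded_linear_hadamard: "bounded_linear (hadamard c)"
  unfolding linear_conv_bounded_linear[symmetric]
  by (rule linearI) (simp_all add: vec_eq_iff algebra_simps)

lemmas has_derivative_hadamard [derivative_intros] =
  bounded_linear.has_derivative[OF bounded_linear_hadamard]

lemma hadamard_inner_commute: "hadamard c a \<bullet> b = a \<bullet> hadamard c b"
  by (simp add: inner_vec_def mult_ac)

lemma hadamard_inner_swap: "b \<bullet> hadamard c a = a \<bullet> hadamard c b"
  by (simp add: inner_vec_def mult_ac)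

text \<open>The common form of both Lagrangians. The bilinear term is written
  \<open>hadamard \<gamma> a \<bullet> b\<close>, so that its gradient is given by the self-adjoint map \<open>hadamard \<gamma>\<close>.\<close>

lemma
  fixes l :: "real^'n \<Rightarrow> real" and \<beta> \<gamma> :: "real^'n" and \<kappa> c :: real
  defines "K \<equiv> (\<lambda>(a, b). l a + c + \<beta> \<bullet> b + \<kappa> / 2 * (b \<bullet> b) + hadamard \<gamma> a \<bullet> b)"
  assumes l: "\<And>a. l differentiable (at a)" and l2: "\<And>a. grad l differentiable (at a)"
  shows grad_separable_bilinear:
      "grad K (a, b) = (grad l a + hadamard \<gamma> b, \<beta> + \<kappa> *\<^sub>R b + hadamard \<gamma> a)"
    and hess_separable_bilinear:
      "(u, v) \<bullet> hess K (a, b) (u, v)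
         = u \<bullet> hess l a u + \<kappa> * (v \<bullet> v) + 2 * (hadamard \<gamma> u \<bullet> v)"
proof -
  define K' where "K' = (\<lambda>z. (grad l (fst z) + hadamard \<gamma> (snd z),
      \<beta> + \<kappa> *\<^sub>R snd z + hadamard \<gamma> (fst z)))"
  have "grad K z = K' z" for z
  proof (rule grad_eqI)
    have "((\<lambda>z. l (fst z)) has_derivative (\<lambda>h. fst h \<bullet> grad l (fst z))) (at z)"
      using has_derivative_compose[OF has_derivative_fst[OF has_derivative_ident]]
        GDERIV_grad[OF l] unfolding gderiv_def by blast
    then show "GDERIV K z :> K' z"
      unfolding gderiv_def K_def K'_def case_prod_beta
      by (auto intro!: derivative_eq_intros ext
          simp: inner_prod_def inner_add_right inner_commute hadamard_inner_commute algebra_simps)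
        (rule hadamard_inner_swap)
  qed
  then have grad_K: "grad K = K'" by blast
  then show "grad K (a, b) = (grad l a + hadamard \<gamma> b, \<beta> + \<kappa> *\<^sub>R b + hadamard \<gamma> a)"
    by (simp add: K'_def)
  have "((\<lambda>z. grad l (fst z)) has_derivative (\<lambda>h. hess l a (fst h))) (at (a, b))"
    using has_derivative_compose[OF has_derivative_fst[OF has_derivative_ident],
        where g = "grad l" and x = "(a, b)"] has_derivative_grad_hess[OF l2]
    by auto
  then have "(grad K has_derivative (\<lambda>h. (hess l a (fst h) + hadamard \<gamma> (snd h),
      \<kappa> *\<^sub>R snd h + hadamard \<gamma> (fst h)))) (at (a, b))"
    unfolding grad_K K'_def by (auto intro!: derivative_eq_intros)
  from hess_eqI[OF this] show "(u, v) \<bullet> hess K (a, b) (u, v)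
      = u \<bullet> hess l a u + \<kappa> * (v \<bullet> v) + 2 * (hadamard \<gamma> u \<bullet> v)"
    by (simp add: inner_add_right hadamard_inner_commute hadamard_inner_swap[of u \<gamma> v])
qed

lemma lagrangian_SPOlin:
  "lagrangian (SPOlin \<rho> f m g p h) (case_sum lam (\<lambda>i. \<sigma> $ i)) (case_sum mu (\<lambda>i. \<gamma> $ i))
     = (\<lambda>(a, b). L_SP f m g p h lam mu a + (\<rho> * real CARD('n) - (\<Sum>i\<in>UNIV. \<sigma> $ i))
         + (\<sigma> - (\<chi> i. \<rho>)) \<bullet> b + 0 / 2 * (b \<bullet> b) + hadamard \<gamma> a \<bullet> b)"
  for \<sigma> \<gamma> :: "real^'n"
  by (auto simp: fun_eq_iff lagrangian_def SPOlin_def L_SP_def sum.Plus inner_vec_def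
      sum_subtractf sum_distrib_left algebra_simps)

lemma lagrangian_SPOsq:
  "lagrangian (SPOsq \<rho> f m g p h) lam (case_sum mu (\<lambda>i. \<gamma> $ i))
     = (\<lambda>(a, b). L_SP f m g p h lam mu a + 0
         + (\<chi> i. - \<rho>) \<bullet> b + \<rho> / 2 * (b \<bullet> b) + hadamard \<gamma> a \<bullet> b)"
  for \<gamma> :: "real^'n"
proof -
  have "\<rho> / 2 * (\<Sum>i\<in>UNIV. b $ i * (b $ i - 2)) = (\<chi> i. - \<rho>) \<bullet> b + \<rho> / 2 * (b \<bullet> b)"
    for b :: "real^'n"
    unfolding inner_vec_def sum_distrib_left sum.distrib[symmetric]
    by (rule sum.cong) (simp_all add: field_simps)
  then show ?thesis
    by (auto simp: fun_eq_iff lagrangian_def SPOsq_def L_SP_def sum.Plus inner_vec_def algebra_simps)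
qed

lemma
  assumes "twice_cont_diff f" "\<And>i. i < m \<Longrightarrow> twice_cont_diff (g i)"
    and "\<And>j. j < p \<Longrightarrow> twice_cont_diff (h j)"
  shows L_SP_differentiable: "L_SP f m g p h lam mu differentiable (at z)"
    and grad_L_SP_differentiable: "grad (L_SP f m g p h lam mu) differentiable (at z)"
    and grad_L_SP: "grad (L_SP f m g p h lam mu) z
      = grad f z + (\<Sum>i<m. lam i *\<^sub>R grad (g i) z) + (\<Sum>j<p. mu j *\<^sub>R grad (h j) z)"
proof -
  note f = assms[unfolded twice_cont_diff_def]
  have eq: "L_SP f m g p h lam mu
      = (\<lambda>z. (\<lambda>z. f z + (\<Sum>i<m. lam i * g i z)) z + (\<Sum>j<p. mu j * h j z))"
    by (simp add: fun_eq_iff L_SP_def)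
  note 1 = grad_differentiable_lincomb[of "{..<m}" f g lam]
  note 2 = grad_differentiable_lincomb[of "{..<p}" "\<lambda>z. f z + (\<Sum>i<m. lam i * g i z)" h mu]
  show "L_SP f m g p h lam mu differentiable (at z)"
    unfolding eq by (rule 2(1)) (use f 1 in auto)
  show "grad (L_SP f m g p h lam mu) differentiable (at z)"
    unfolding eq by (rule 2(3)) (use f 1 in auto)
  have "grad (L_SP f m g p h lam mu) z
      = grad (\<lambda>z. f z + (\<Sum>i<m. lam i * g i z)) z + (\<Sum>j<p. mu j *\<^sub>R grad (h j) z)"
    unfolding eq by (rule 2(2)) (use f 1 in auto)
  then show "grad (L_SP f m g p h lam mu) z
      = grad f z + (\<Sum>i<m. lam i *\<^sub>R grad (g i) z) + (\<Sum>j<p. mu j *\<^sub>R grad (h j) z)"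
    using 1(2) f by simp
qed

section \<open>Limits of difference quotients along a sequence of directions\<close>

lemma difference_quotient_tendsto:
  fixes F :: "'a::real_normed_vector \<Rightarrow> 'b::real_normed_vector"
  assumes F: "(F has_derivative F') (at x)"
    and w: "w \<longlonglongrightarrow> x" "\<And>n. w n \<noteq> x"
    and d: "(\<lambda>n. (w n - x) /\<^sub>R norm (w n - x)) \<longlonglongrightarrow> d"
  shows "(\<lambda>n. (F (w n) - F x) /\<^sub>R norm (w n - x)) \<longlonglongrightarrow> F' d"
proof -
  interpret F': bounded_linear F' using F by (rule has_derivative_bounded_linear)
  have "((\<lambda>y. (F y - F x - F' (y - x)) /\<^sub>R norm (y - x)) \<longlongrightarrow> 0) (at x)"
    by (rule tendsto_norm_zero_cancel)
      (use F in \<open>simp add: has_derivative_iff_norm divide_inverse mult.commute\<close>)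
  moreover have "filterlim w (at x) sequentially"
    using w by (simp add: filterlim_at)
  ultimately have "(\<lambda>n. (F (w n) - F x - F' (w n - x)) /\<^sub>R norm (w n - x)) \<longlonglongrightarrow> 0"
    by (rule filterlim_compose)
  moreover have "(\<lambda>n. F' ((w n - x) /\<^sub>R norm (w n - x))) \<longlonglongrightarrow> F' d"
    using d by (rule F'.tendsto)
  ultimately have "(\<lambda>n. (F (w n) - F x - F' (w n - x)) /\<^sub>R norm (w n - x)
      + F' ((w n - x) /\<^sub>R norm (w n - x))) \<longlonglongrightarrow> 0 + F' d"
    by (rule tendsto_add)
  then show ?thesis by (simp add: F'.scaleR flip: scaleR_add_right)
qed

lemma grad_inner_limit_direction:
  fixes F :: "'z::euclidean_space \<Rightarrow> real"
  assumes F: "F differentiable (at x)"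
    and w: "w \<longlonglongrightarrow> x" "\<And>n. w n \<noteq> x"
    and d: "(\<lambda>n. (w n - x) /\<^sub>R norm (w n - x)) \<longlonglongrightarrow> d"
  shows "(\<lambda>n. (F (w n) - F x) /\<^sub>R norm (w n - x)) \<longlonglongrightarrow> grad F x \<bullet> d"
  using difference_quotient_tendsto[OF GDERIV_grad[OF F, unfolded gderiv_def] w d]
  by (simp add: inner_commute)

lemma grad_inner_limit_direction_nonpos:
  fixes F :: "'z::euclidean_space \<Rightarrow> real"
  assumes "F differentiable (at x)"
    and "w \<longlonglongrightarrow> x" "\<And>n. w n \<noteq> x"
    and "(\<lambda>n. (w n - x) /\<^sub>R norm (w n - x)) \<longlonglongrightarrow> d"
    and "\<And>n. F (w n) \<le> F x"
  shows "grad F x \<bullet> d \<le> 0"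
  using grad_inner_limit_direction[OF assms(1-4)]
  by (rule LIMSEQ_le_const2) (auto simp: assms(5) mult_nonneg_nonpos intro!: exI[of _ 0])

text \<open>Second-order necessary inequality in the limit direction of a sequence of points at which
  \<open>L\<close> does not exceed \<open>L x\<close>, with displacements orthogonal to the gradient of \<open>L\<close> at \<open>x\<close>.
  By the mean value theorem,
  \<open>L (w n) - L x\<close> is the directional derivative in direction \<open>w n - x\<close> at an intermediate point
  \<open>z n\<close>; differentiating the gradient along \<open>z n\<close>, whose normalized directions from \<open>x\<close> are those
  of \<open>w n\<close>, gives the inequality without a Taylor expansion or symmetry of the Hessian.\<close>

lemma hess_limit_direction_nonpos:
  fixes L :: "'z::euclidean_space \<Rightarrow> real"
  assumes L: "\<And>z. L differentiable (at z)" and L2: "grad L differentiable (at x)"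
    and w: "w \<longlonglongrightarrow> x" "\<And>n. w n \<noteq> x"
    and d: "(\<lambda>n. (w n - x) /\<^sub>R norm (w n - x)) \<longlonglongrightarrow> d"
    and le: "\<And>n. L (w n) \<le> L x"
    and orth: "\<And>n. grad L x \<bullet> (w n - x) = 0"
  shows "d \<bullet> hess L x d \<le> 0"
proof -
  have "\<exists>s. 0 < s \<and> s < 1 \<and> grad L (x + s *\<^sub>R (w n - x)) \<bullet> (w n - x) \<le> 0" for n
  proof -
    have "((\<lambda>t. L (x + t *\<^sub>R (w n - x))) has_derivative
        (\<lambda>r. r * (grad L (x + t *\<^sub>R (w n - x)) \<bullet> (w n - x)))) (at t within {0..1})" for t
    proof -
      have "((\<lambda>t. x + t *\<^sub>R (w n - x)) has_derivative (\<lambda>r. r *\<^sub>R (w n - x))) (at t within {0..1})"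
        by (auto intro!: derivative_eq_intros)
      from has_derivative_compose[OF this GDERIV_grad[OF L, unfolded gderiv_def]]
      show ?thesis by (simp add: inner_commute)
    qed
    then have "\<exists>s\<in>{0<..<1}. L (x + 1 *\<^sub>R (w n - x)) - L (x + 0 *\<^sub>R (w n - x))
        = (1 - 0) * (grad L (x + s *\<^sub>R (w n - x)) \<bullet> (w n - x))"
      by (intro mvt_simple) simp_all
    with le[of n] show ?thesis by auto
  qed
  then obtain s where s: "\<And>n. 0 < s n" "\<And>n. s n < 1"
    and mvt: "\<And>n. grad L (x + s n *\<^sub>R (w n - x)) \<bullet> (w n - x) \<le> 0"
    by metis
  define z where "z n = x + s n *\<^sub>R (w n - x)" for n
  have "z \<longlonglongrightarrow> x"
  proof -
    have "(\<lambda>n. norm (w n - x)) \<longlonglongrightarrow> 0"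
      using w(1) by (simp add: LIM_zero_iff tendsto_norm_zero_iff)
    then have "(\<lambda>n. z n - x) \<longlonglongrightarrow> 0"
    proof (rule Lim_null_comparison[rotated])
      have "s n * norm (w n - x) \<le> norm (w n - x)" for n
        using s[of n] by (simp add: mult_left_le_one_le)
      then show "\<forall>\<^sub>F n in sequentially. norm (z n - x) \<le> norm (w n - x)"
        using s(1) by (simp add: z_def abs_of_pos)
    qed
    then show ?thesis by (simp add: LIM_zero_iff)
  qed
  moreover have "z n \<noteq> x" for n
    using s(1)[of n] w(2)[of n] by (simp add: z_def)
  moreover have dir: "(z n - x) /\<^sub>R norm (z n - x) = (w n - x) /\<^sub>R norm (w n - x)" for n
    using s(1)[of n] by (simp add: z_def)
  ultimately have "(\<lambda>n. (grad L (z n) - grad L x) /\<^sub>R norm (z n - x)) \<longlonglongrightarrow> hess L x d"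
    using difference_quotient_tendsto[OF has_derivative_grad_hess[OF L2], of z d] d by simp
  then have "(\<lambda>n. ((w n - x) /\<^sub>R norm (w n - x)) \<bullet> ((grad L (z n) - grad L x) /\<^sub>R norm (z n - x)))
      \<longlonglongrightarrow> d \<bullet> hess L x d"
    using d by (intro tendsto_inner)
  then show ?thesis
  proof (rule LIMSEQ_le_const2, intro exI allI impI)
    fix n
    show "((w n - x) /\<^sub>R norm (w n - x)) \<bullet> ((grad L (z n) - grad L x) /\<^sub>R norm (z n - x)) \<le> 0"
    proof -
      have "(w n - x) \<bullet> (grad L (z n) - grad L x) \<le> 0"
        using mvt[of n] orth[of n] by (simp add: z_def inner_diff_right inner_commute)
      then show ?thesis by (simp add: mult_nonneg_nonpos)
    qed
  qed
qed

section \<open>Local optimality for the sparse problem\<close>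

text \<open>Otherwise better points \<open>w n\<close> with support in that of \<open>x\<close> converge to \<open>x\<close>. A limit \<open>d\<close> of
  their normalized displacements lies in the critical cone, and \<open>L (w n) \<le> L x\<close> gives
  \<open>d \<bullet> hess L x d \<le> 0\<close>, contradicting the second-order condition.\<close>

lemma local_min_on_support:
  fixes x :: "real^'n"
  assumes f: "twice_cont_diff f" and g: "\<And>i. i < m \<Longrightarrow> twice_cont_diff (g i)"
    and h: "\<And>j. j < p \<Longrightarrow> twice_cont_diff (h j)"
    and st: "S_stationary f m g p h x lam mu"
    and so: "SP_SOSC f m g p h x lam mu"
  shows "\<exists>\<epsilon>>0. \<forall>w\<in>feasible_X m g p h. dist w x < \<epsilon> \<longrightarrow>
           (\<forall>i. x $ i = 0 \<longrightarrow> w $ i = 0) \<longrightarrow> f x \<le> f w"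
proof (rule ccontr)
  let ?better = "\<lambda>w. w \<in> feasible_X m g p h \<and> (\<forall>i. x $ i = 0 \<longrightarrow> w $ i = 0) \<and> f w < f x"
  assume "\<not> ?thesis"
  then have "\<exists>w. ?better w \<and> dist w x < \<epsilon>" if "\<epsilon> > 0" for \<epsilon>
    using that unfolding not_le[symmetric] by blast
  then have "\<forall>n. \<exists>w. ?better w \<and> dist w x < inverse (real (Suc n))"
    by (meson inverse_positive_iff_positive of_nat_0_less_iff zero_less_Suc)
  then obtain w0 where better: "\<And>n. ?better (w0 n)"
    and dist: "\<And>n. dist (w0 n) x < inverse (real (Suc n))"
    using choice[of "\<lambda>n w. ?better w \<and> dist w x < inverse (real (Suc n))"] by blast
  have w0: "w0 n \<in> feasible_X m g p h" "x $ i = 0 \<Longrightarrow> w0 n $ i = 0" "f (w0 n) < f x" for n i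
    using better by blast+
  have w0x: "w0 n \<noteq> x" for n using w0(3)[of n] by (metis less_irrefl)
  have "(\<lambda>n. dist (w0 n) x) \<longlonglongrightarrow> 0"
  proof (rule tendsto_sandwich[OF _ _ tendsto_const LIMSEQ_inverse_real_of_nat])
    show "\<forall>\<^sub>F n in sequentially. dist (w0 n) x \<le> inverse (real (Suc n))"
      by (intro always_eventually allI less_imp_le dist)
  qed simp
  then have "w0 \<longlonglongrightarrow> x" by (rule tendsto_dist_iff[THEN iffD2])
  \<comment> \<open>Pass to a subsequence along which the normalized directions converge.\<close>
  have "\<forall>n. (w0 n - x) /\<^sub>R norm (w0 n - x) \<in> sphere 0 1"
    using w0x by simp
  then obtain d r where d: "d \<in> sphere 0 1" and r: "strict_mono (r :: nat \<Rightarrow> nat)"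
    and dlim: "((\<lambda>n. (w0 n - x) /\<^sub>R norm (w0 n - x)) \<circ> r) \<longlonglongrightarrow> d"
    by (rule seq_compactE[OF compact_imp_seq_compact[OF compact_sphere]])
  define w where "w = w0 \<circ> r"
  have w: "w \<longlonglongrightarrow> x" "\<And>n. w n \<noteq> x" "(\<lambda>n. (w n - x) /\<^sub>R norm (w n - x)) \<longlonglongrightarrow> d"
    unfolding w_def using LIMSEQ_subseq_LIMSEQ[OF \<open>w0 \<longlonglongrightarrow> x\<close> r] w0x dlim
    by (simp_all only: o_def not_False_eq_True)
  have wX: "\<And>n i. i < m \<Longrightarrow> g i (w n) \<le> 0" "\<And>n j. j < p \<Longrightarrow> h j (w n) = 0"
    "\<And>n i. x $ i = 0 \<Longrightarrow> w n $ i = 0" "\<And>n. f (w n) < f x"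
    using w0 by (simp_all add: w_def feasible_X_def)
  have xX: "\<And>i. i < m \<Longrightarrow> g i x \<le> 0 \<and> lam i \<ge> 0 \<and> lam i * g i x = 0" "\<And>j. j < p \<Longrightarrow> h j x = 0"
    and gradL: "\<And>i. x $ i \<noteq> 0 \<Longrightarrow> grad (L_SP f m g p h lam mu) x $ i = 0"
    using st by (simp_all add: S_stationary_def)
  have diff: "f differentiable (at z)" "i < m \<Longrightarrow> g i differentiable (at z)"
    "j < p \<Longrightarrow> h j differentiable (at z)" for i j z
    using f g h by (simp_all add: twice_cont_diff_def)
  let ?L = "L_SP f m g p h lam mu"
  have dsupp: "d $ i = 0" if "x $ i = 0" for i
    using tendsto_vec_nth[OF w(3), of i] that wX(3)[OF that] by (simp add: LIMSEQ_const_iff)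
  have df: "grad f x \<bullet> d \<le> 0"
    using diff w wX(4) by (intro grad_inner_limit_direction_nonpos[of f x w]) (auto intro: less_imp_le)
  have dg: "grad (g i) x \<bullet> d \<le> 0" if "i < m" "g i x = 0" for i
    using diff w wX(1)[OF that(1)] that by (intro grad_inner_limit_direction_nonpos[of "g i" x w]) auto
  have dh: "grad (h j) x \<bullet> d = 0" if "j < p" for j
    using grad_inner_limit_direction[OF diff(3)[OF that] w] wX(2)[OF that] xX(2)[OF that]
    by (simp add: LIMSEQ_const_iff)
  have lamdg: "lam i * (grad (g i) x \<bullet> d) \<le> 0" if "i < m" for i
    using xX(1)[OF that] dg[OF that] by (cases "g i x = 0") (auto simp: mult_nonneg_nonpos)
  have orth: "grad ?L x \<bullet> u = 0" if "\<And>i. x $ i = 0 \<Longrightarrow> u $ i = 0" for u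
    unfolding inner_vec_def
  proof (intro sum.neutral ballI)
    show "grad ?L x $ i \<bullet> u $ i = 0" for i
      using gradL[of i] that[of i] by (cases "x $ i = 0") simp_all
  qed
  \<comment> \<open>All summands are nonpositive, so stationarity makes each of them vanish; this turns the
    inequalities with positive multipliers into the equations defining the critical cone.\<close>
  have "grad f x \<bullet> d + (\<Sum>i<m. lam i * (grad (g i) x \<bullet> d)) = 0"
    using orth[OF dsupp] dh
    by (simp add: grad_L_SP[OF f g h] inner_add_left inner_sum_left)
  then have "(\<Sum>i<m. - (lam i * (grad (g i) x \<bullet> d))) \<le> 0"
    using df by (simp add: sum_negf)
  moreover have "(\<Sum>i<m. - (lam i * (grad (g i) x \<bullet> d))) \<ge> 0"
    using lamdg by (intro sum_nonneg) simp
  ultimately have "(\<Sum>i<m. - (lam i * (grad (g i) x \<bullet> d))) = 0"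
    by linarith
  then have "\<forall>i\<in>{..<m}. - (lam i * (grad (g i) x \<bullet> d)) = 0"
    by (subst (asm) sum_nonneg_eq_0_iff) (simp_all add: lamdg)
  then have "grad (g i) x \<bullet> d = 0" if "i < m" "lam i > 0" for i
    using that by force
  then have "d \<in> C_SPO m g p h x lam"
    using dg dh dsupp by (simp add: C_SPO_def)
  moreover have "d \<noteq> 0" using d by auto
  ultimately have "d \<bullet> hess ?L x d > 0"
    using so by (simp add: SP_SOSC_def)
  moreover have "d \<bullet> hess ?L x d \<le> 0"
  proof (rule hess_limit_direction_nonpos[OF _ _ w])
    show "?L (w n) \<le> ?L x" for n
    proof -
      have "(\<Sum>i<m. lam i * g i (w n)) \<le> 0"
        using xX wX by (intro sum_nonpos) (auto intro: mult_nonneg_nonpos)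
      moreover have "(\<Sum>i<m. lam i * g i x) = 0"
        by (intro sum.neutral ballI) (simp only: xX lessThan_iff)
      moreover have "(\<Sum>j<p. mu j * h j (w n)) = 0" "(\<Sum>j<p. mu j * h j x) = 0"
        by (simp_all add: wX(2) xX(2))
      ultimately show ?thesis using wX(4)[of n] by (simp add: L_SP_def)
    qed
    show "grad ?L x \<bullet> (w n - x) = 0" for n
      by (rule orth) (simp add: wX(3))
  qed (simp_all add: L_SP_differentiable grad_L_SP_differentiable f g h)
  ultimately show False by simp
qed

text \<open>Near \<open>x\<close> the support can only grow. A point with a strictly larger support pays at least
  \<open>\<rho>\<close> more, while \<open>f\<close> changes by less than \<open>\<rho>\<close>; a point with the same support is covered
  by the assumption.\<close>

lemma local_minimizer_SPO_if_on_support: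
  fixes x :: "real^'n"
  assumes "\<rho> > 0" and f: "isCont f x" and x: "x \<in> feasible_X m g p h"
    and min: "\<exists>\<epsilon>>0. \<forall>w\<in>feasible_X m g p h. dist w x < \<epsilon> \<longrightarrow>
           (\<forall>i. x $ i = 0 \<longrightarrow> w $ i = 0) \<longrightarrow> f x \<le> f w"
  shows "local_minimizer (SPO_obj \<rho> f) (feasible_X m g p h) x"
proof -
  have "\<forall>\<^sub>F w in nhds x. \<bar>f w - f x\<bar> < \<rho>"
    using tendstoD[of f "f x" "nhds x" \<rho>] f \<open>\<rho> > 0\<close>
    by (simp add: isCont_def tendsto_at_iff_tendsto_nhds dist_real_def)
  moreover have "\<forall>\<^sub>F w in nhds x. \<forall>i. x $ i \<noteq> 0 \<longrightarrow> w $ i \<noteq> 0"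
  proof (rule eventually_all_finite)
    show "\<forall>\<^sub>F w in nhds x. x $ i \<noteq> 0 \<longrightarrow> w $ i \<noteq> 0" for i
      using tendsto_imp_eventually_ne[OF tendsto_vec_nth[OF filterlim_ident], of x i 0]
      by (cases "x $ i = 0") simp_all
  qed
  moreover have "\<forall>\<^sub>F w in nhds x. w \<in> feasible_X m g p h \<longrightarrow>
      (\<forall>i. x $ i = 0 \<longrightarrow> w $ i = 0) \<longrightarrow> f x \<le> f w"
    using min unfolding eventually_nhds_metric by blast
  ultimately have "\<forall>\<^sub>F w in nhds x. w \<in> feasible_X m g p h \<longrightarrow> SPO_obj \<rho> f x \<le> SPO_obj \<rho> f w"
  proof eventually_elim
    case (elim w)
    have sub: "{i. x $ i \<noteq> 0} \<subseteq> {i. w $ i \<noteq> 0}" using elim by auto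
    show ?case
    proof
      assume wX: "w \<in> feasible_X m g p h"
      show "SPO_obj \<rho> f x \<le> SPO_obj \<rho> f w"
      proof (cases "\<forall>i. x $ i = 0 \<longrightarrow> w $ i = 0")
        case True
        moreover have "l0 x \<le> l0 w"
          unfolding l0_def by (rule card_mono[OF _ sub]) simp
        ultimately show ?thesis
          using elim wX \<open>\<rho> > 0\<close> by (simp add: SPO_obj_def add_mono)
      next
        case False
        then have "{i. x $ i \<noteq> 0} \<subset> {i. w $ i \<noteq> 0}" using sub by auto
        then have "l0 x + 1 \<le> l0 w"
          unfolding l0_def using psubset_card_mono[of "{i. w $ i \<noteq> 0}"] by (simp add: Suc_le_eq)
        then have "real (l0 x) + 1 \<le> real (l0 w)" by linarith
        then have "\<rho> * (real (l0 x) + 1) \<le> \<rho> * real (l0 w)"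
          using \<open>\<rho> > 0\<close> by simp
        then show ?thesis
          using elim(1) by (simp add: SPO_obj_def algebra_simps)
      qed
    qed
  qed
  then show ?thesis
    using x unfolding local_minimizer_def eventually_nhds_metric by blast
qed

lemma local_minimizer_SPO:
  assumes "\<rho> > 0" and f: "twice_cont_diff f" and g: "\<And>i. i < m \<Longrightarrow> twice_cont_diff (g i)"
    and h: "\<And>j. j < p \<Longrightarrow> twice_cont_diff (h j)"
    and st: "S_stationary f m g p h x lam mu" and so: "SP_SOSC f m g p h x lam mu"
  shows "local_minimizer (SPO_obj \<rho> f) (feasible_X m g p h) x"
proof (rule local_minimizer_SPO_if_on_support[OF \<open>\<rho> > 0\<close>])
  show "isCont f x"
    using f differentiable_imp_continuous_within by (auto simp: twice_cont_diff_def)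
  show "x \<in> feasible_X m g p h"
    using st by (simp add: S_stationary_def feasible_X_def)
qed (rule local_min_on_support[OF f _ _ st so]; fact g h)

section \<open>Second-order conditions for the reformulations\<close>

context
  fixes \<rho> :: real
    and m p :: nat
    and f :: "real^'n \<Rightarrow> real"
    and g h :: "nat \<Rightarrow> real^'n \<Rightarrow> real"
    and x y \<gamma> \<sigma> :: "real^'n"
    and lam mu :: "nat \<Rightarrow> real"
  assumes \<rho>: "\<rho> > 0"
    and f: "twice_cont_diff f"
    and g: "\<And>i. i < m \<Longrightarrow> twice_cont_diff (g i)"
    and h: "\<And>j. j < p \<Longrightarrow> twice_cont_diff (h j)"
    and st: "S_stationary f m g p h x lam mu"
    and y: "y = (\<chi> i. if x $ i = 0 then 1 else 0)"
    and \<gamma>: "\<gamma> = (\<chi> i. if x $ i = 0 then - (grad (L_SP f m g p h lam mu) x $ i) else \<rho> / x $ i)"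
    and \<sigma>: "\<sigma> = (\<chi> i. if x $ i = 0 then \<rho> else 0)"
begin

private abbreviation (input) "Plin \<equiv> SPOlin \<rho> f m g p h"
private abbreviation (input) "Psq \<equiv> SPOsq \<rho> f m g p h"
private abbreviation (input) "Ulin \<equiv> case_sum lam (\<lambda>i. \<sigma> $ i)"
private abbreviation (input) "V \<equiv> case_sum mu (\<lambda>i. \<gamma> $ i)"
private abbreviation (input) "L \<equiv> L_SP f m g p h lam mu"

private lemma L_diff: "L differentiable (at z)" "grad L differentiable (at z)"
  by (simp_all add: L_SP_differentiable grad_L_SP_differentiable f g h)

text \<open>In the \<open>b\<close>-variables the gradient of the Lagrangian has the components
  \<open>- \<rho> + \<sigma> i + \<gamma> i * x i\<close> in the linear and \<open>\<rho> * (y i - 1) + \<gamma> i * x i\<close> in the quadratic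
  case. Both vanish: \<open>\<sigma> i = \<rho>\<close> and \<open>y i = 1\<close> if \<open>x i = 0\<close>, and \<open>\<gamma> i * x i = \<rho>\<close> otherwise. In the
  \<open>a\<close>-variables, \<open>\<gamma> i * y i\<close> cancels the gradient of \<open>L\<close> where \<open>x i = 0\<close>.\<close>

lemma KKT_SPOlin: "KKT Plin (x, y) Ulin V"
  unfolding KKT_def lagrangian_SPOlin grad_separable_bilinear[OF L_diff]
  using st \<rho> by (auto simp: SPOlin_def S_stationary_def y \<gamma> \<sigma> vec_eq_iff zero_prod_def split: sum.split)

lemma KKT_SPOsq: "KKT Psq (x, y) lam V"
  unfolding KKT_def lagrangian_SPOsq grad_separable_bilinear[OF L_diff]
  using st \<rho> by (auto simp: SPOsq_def S_stationary_def y \<gamma> vec_eq_iff zero_prod_def split: sum.split)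

private lemma grad_constraints:
  shows "i < m \<Longrightarrow> grad (\<lambda>(x, y). g i x) (x, y) = (grad (g i) x, 0 :: real^'n)"
    and "j < p \<Longrightarrow> grad (\<lambda>(x, y). h j x) (x, y) = (grad (h j) x, 0 :: real^'n)"
  using g h by (auto intro!: grad_fst simp: twice_cont_diff_def)

private lemma grad_bound:
  "grad (\<lambda>(x, y). y $ i - 1) (x :: real^'n, y :: real^'n) = (0, axis i 1)"
  by (rule grad_eqI)
    (auto simp: gderiv_def case_prod_beta inner_prod_def inner_axis
      intro!: derivative_eq_intros bounded_linear.has_derivative[OF bounded_linear_vec_nth])

private lemma grad_product:
  "grad (\<lambda>(x, y). x $ i * y $ i) (x :: real^'n, y :: real^'n) = (axis i (y $ i), axis i (x $ i))"
  by (rule grad_eqI)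
    (auto simp: gderiv_def case_prod_beta inner_prod_def inner_axis
      intro!: derivative_eq_intros bounded_linear.has_derivative[OF bounded_linear_vec_nth])

text \<open>The left-hand side is the \<open>i\<close>-th component of the linearization of \<open>x \<circ> y = 0\<close> at \<open>(x, y)\<close>,
  where exactly one of \<open>x i\<close> and \<open>y i\<close> vanishes.\<close>

private lemma linearized_product:
  "y $ i * u $ i + x $ i * v $ i = 0 \<longleftrightarrow> (if x $ i = 0 then u $ i = 0 else v $ i = 0)"
  by (simp add: y)

private lemma Ball_Plus:
  "(\<forall>k\<in>A <+> B. Q k) \<longleftrightarrow> (\<forall>a\<in>A. Q (Inl a)) \<and> (\<forall>b\<in>B. Q (Inr b))"
  by auto

private lemmas critical_simps =
  grad_constraints grad_bound grad_product linearized_product inner_axis' Ball_Plus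

lemma critical_SPOlin:
  shows "(u, v) \<in> critical_subspace Plin (x, y) Ulin \<longleftrightarrow> u \<in> SC_SPO m g p h x lam \<and> v = 0"
    and "(u, v) \<in> critical_cone Plin (x, y) Ulin \<longleftrightarrow> u \<in> C_SPO m g p h x lam \<and> v = 0"
proof -
  have active: "y $ i = 1 \<and> 0 < \<sigma> $ i \<longleftrightarrow> x $ i = 0" "\<not> (y $ i = 1 \<and> \<sigma> $ i = 0)" for i
    using \<rho> by (simp_all add: y \<sigma>)
  \<comment> \<open>The active bounds give the first half of \<open>v = 0\<close>, the linearized product the second.\<close>
  have v0: "v = 0 \<longleftrightarrow> (\<forall>i. x $ i = 0 \<longrightarrow> v $ i = 0) \<and> (\<forall>i. x $ i \<noteq> 0 \<longrightarrow> v $ i = 0)"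
    by (auto simp: vec_eq_iff)
  show "(u, v) \<in> critical_subspace Plin (x, y) Ulin \<longleftrightarrow> u \<in> SC_SPO m g p h x lam \<and> v = 0"
    unfolding v0 critical_subspace_def SC_SPO_def
    by (auto simp: SPOlin_def critical_simps active split: if_splits)
  show "(u, v) \<in> critical_cone Plin (x, y) Ulin \<longleftrightarrow> u \<in> C_SPO m g p h x lam \<and> v = 0"
    unfolding v0 critical_cone_def C_SPO_def
    by (auto simp: SPOlin_def critical_simps active split: if_splits)
qed

lemma critical_SPOsq:
  shows "(u, v) \<in> critical_subspace Psq (x, y) lam \<longleftrightarrow>
      u \<in> SC_SPO m g p h x lam \<and> (\<forall>i. x $ i \<noteq> 0 \<longrightarrow> v $ i = 0)"
    and "(u, v) \<in> critical_cone Psq (x, y) lam \<longleftrightarrow>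
      u \<in> C_SPO m g p h x lam \<and> (\<forall>i. x $ i \<noteq> 0 \<longrightarrow> v $ i = 0)"
  unfolding critical_subspace_def SC_SPO_def critical_cone_def C_SPO_def
  by (auto simp: SPOsq_def critical_simps split: if_splits)

text \<open>The Hessian form is needed only for \<open>v = 0\<close>, which holds on the critical subspace.\<close>

lemma hess_form_SPOlin:
  "(u, 0) \<bullet> hess (lagrangian Plin Ulin V) (x, y) (u, 0) = u \<bullet> hess L x u"
  unfolding lagrangian_SPOlin hess_separable_bilinear[OF L_diff] by simp

text \<open>The bilinear term vanishes since \<open>u\<close> and \<open>v\<close> have complementary supports.\<close>

lemma hess_form_SPOsq:
  assumes "\<And>i. x $ i = 0 \<Longrightarrow> u $ i = 0" "\<And>i. x $ i \<noteq> 0 \<Longrightarrow> v $ i = 0"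
  shows "(u, v) \<bullet> hess (lagrangian Psq lam V) (x, y) (u, v) = u \<bullet> hess L x u + \<rho> * (v \<bullet> v)"
proof -
  have "hadamard \<gamma> u \<bullet> v = 0"
    unfolding inner_vec_def by (rule sum.neutral) (use assms in fastforce)
  then show ?thesis
    unfolding lagrangian_SPOsq hess_separable_bilinear[OF L_diff] by simp
qed

lemma hess_form_SPOsq_pos:
  assumes pos: "u \<noteq> 0 \<Longrightarrow> u \<bullet> hess L x u > 0"
    and supp: "\<And>i. x $ i = 0 \<Longrightarrow> u $ i = 0" "\<And>i. x $ i \<noteq> 0 \<Longrightarrow> v $ i = 0"
    and nz: "(u, v) \<noteq> 0"
  shows "(u, v) \<bullet> hess (lagrangian Psq lam V) (x, y) (u, v) > 0"
proof -
  have form: "(u, v) \<bullet> hess (lagrangian Psq lam V) (x, y) (u, v) = u \<bullet> hess L x u + \<rho> * (v \<bullet> v)"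
    by (rule hess_form_SPOsq) (use supp in auto)
  show ?thesis
  proof (cases "u = 0")
    case True
    with nz have "v \<noteq> 0" by (simp add: zero_prod_def)
    have "u \<bullet> hess L x u = 0" using True by simp
    with \<open>v \<noteq> 0\<close> \<rho> show ?thesis unfolding form by simp
  next
    case False
    with pos \<rho> show ?thesis unfolding form by (simp add: add_pos_nonneg)
  qed
qed

lemma SOSC_SPOlin:
  shows "SP_SOSC f m g p h x lam mu \<Longrightarrow> SOSC Plin (x, y) Ulin V"
    and "strong_SP_SOSC f m g p h x lam mu \<Longrightarrow> strong_SOSC Plin (x, y) Ulin V"
  using KKT_SPOlin
  by (auto simp: SOSC_def strong_SOSC_def SP_SOSC_def strong_SP_SOSC_def critical_SPOlin
      hess_form_SPOlin zero_prod_def)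

lemma SOSC_SPOsq:
  shows "SP_SOSC f m g p h x lam mu \<Longrightarrow> SOSC Psq (x, y) lam V"
    and "strong_SP_SOSC f m g p h x lam mu \<Longrightarrow> strong_SOSC Psq (x, y) lam V"
  using KKT_SPOsq
  by (auto simp: SOSC_def strong_SOSC_def SP_SOSC_def strong_SP_SOSC_def critical_SPOsq
      C_SPO_def SC_SPO_def intro!: hess_form_SPOsq_pos)

end

lemma strong_SP_SOSC_imp_SP_SOSC:
  "strong_SP_SOSC f m g p h x lam mu \<Longrightarrow> SP_SOSC f m g p h x lam mu"
  by (auto simp: strong_SP_SOSC_def SP_SOSC_def C_SPO_def SC_SPO_def)

theorem theorem5p3:
  fixes \<rho> :: real
    and m p :: nat
    and f :: "real^'n \<Rightarrow> real"
    and g h :: "nat \<Rightarrow> real^'n \<Rightarrow> real"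
    and x y \<gamma> \<sigma> :: "real^'n"
    and lam mu :: "nat \<Rightarrow> real"
  assumes "\<rho> > 0"
    and "twice_cont_diff f"
    and "\<And>i. i < m \<Longrightarrow> twice_cont_diff (g i)"
    and "\<And>j. j < p \<Longrightarrow> twice_cont_diff (h j)"
    and "S_stationary f m g p h x lam mu"
    and "y = (\<chi> i. if x $ i = 0 then 1 else 0)"
    and "\<gamma> = (\<chi> i. if x $ i = 0 then - (grad (L_SP f m g p h lam mu) x $ i) else \<rho> / x $ i)"
    and "\<sigma> = (\<chi> i. if x $ i = 0 then \<rho> else 0)"
  shows "(SP_SOSC f m g p h x lam mu \<longrightarrow>
            SOSC (SPOlin \<rho> f m g p h) (x, y)
              (case_sum lam (\<lambda>i. \<sigma> $ i)) (case_sum mu (\<lambda>i. \<gamma> $ i)) \<and>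
            SOSC (SPOsq \<rho> f m g p h) (x, y) lam (case_sum mu (\<lambda>i. \<gamma> $ i)) \<and>
            local_minimizer (SPO_obj \<rho> f) (feasible_X m g p h) x) \<and>
         (strong_SP_SOSC f m g p h x lam mu \<longrightarrow>
            strong_SOSC (SPOlin \<rho> f m g p h) (x, y)
              (case_sum lam (\<lambda>i. \<sigma> $ i)) (case_sum mu (\<lambda>i. \<gamma> $ i)) \<and>
            strong_SOSC (SPOsq \<rho> f m g p h) (x, y) lam (case_sum mu (\<lambda>i. \<gamma> $ i)) \<and>
            local_minimizer (SPO_obj \<rho> f) (feasible_X m g p h) x)"
proof (intro conjI impI)
  assume so: "SP_SOSC f m g p h x lam mu"
  show "SOSC (SPOlin \<rho> f m g p h) (x, y)
          (case_sum lam (\<lambda>i. \<sigma> $ i)) (case_sum mu (\<lambda>i. \<gamma> $ i))"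
    by (rule SOSC_SPOlin(1); fact)
  show "SOSC (SPOsq \<rho> f m g p h) (x, y) lam (case_sum mu (\<lambda>i. \<gamma> $ i))"
    by (rule SOSC_SPOsq(1); fact)
  show "local_minimizer (SPO_obj \<rho> f) (feasible_X m g p h) x"
    by (rule local_minimizer_SPO; fact)
next
  assume so: "strong_SP_SOSC f m g p h x lam mu"
  show "strong_SOSC (SPOlin \<rho> f m g p h) (x, y)
          (case_sum lam (\<lambda>i. \<sigma> $ i)) (case_sum mu (\<lambda>i. \<gamma> $ i))"
    by (rule SOSC_SPOlin(2); fact)
  show "strong_SOSC (SPOsq \<rho> f m g p h) (x, y) lam (case_sum mu (\<lambda>i. \<gamma> $ i))"
    by (rule SOSC_SPOsq(2); fact)
  have "SP_SOSC f m g p h x lam mu" using so by (rule strong_SP_SOSC_imp_SP_SOSC)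
  show "local_minimizer (SPO_obj \<rho> f) (feasible_X m g p h) x"
    by (rule local_minimizer_SPO; fact)
qed

end
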